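(* Let $p>2$ be a prime, let $t$ be a positive divisor of $p-1$, let $k$ be an integer with $1<k<p/2$, let $a\in\mathbb{F}_p^*$ and let $x_0\in U(k,t,a)$. Put $r_0(k)=\left\lfloor \frac{\log(p/2)}{\log k}\right\rfloor$ and $s=s_0(k,t)=\max\left\{s'\in\mathbb{Z}_{\ge 0}~:~\binom{r_0(k)+s'}{s'}\le t\right\}$. Then $$\#\{|x|~:~x\in U(k,t,a),\ (x,x_0)=1\}\le\Psi(k,p_{s}).$$
   Context: $\mathbb{F}_p$ is the field of residues modulo $p$, $\mathbb{F}_p^*=\mathbb{F}_p\setminus\{0\}$. For $x\in\mathbb{F}_p$ its integer height is $|x|=\min\{|a|~:~a\in\mathbb{Z},\ a\equiv x \pmod p\}$; elements of $\mathbb{F}_p$ of integer height $<p/2$ are identified with their integer representative of minimal absolute value, and $(x,x_0)$ denotes the greatest common divisor of these integer representatives. For $t\mid p-1$, $G$ is the unique subgroup of $\mathbb{F}_p^*$ of order $t$, $aG=\{ag~:~g\in G\}$, and $U(k,t,a)=\{x\in aG~:~|x|\le k\}$. $\Psi(x,y)$ is the number of positive integers $n\le x$ all of whose prime factors are at most $y$. $p_j$ is the $j$-th prime ($p_1=2$); by convention $p_0$-smooth integers are those with no prime factors, so $\Psi(x,p_0)=1$ for $x\ge1$. *)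

theory Defs
  imports Complex_Main "HOL-Library.Infinite_Set" "HOL-Number_Theory.Number_Theory"
    "HOL-Algebra.Coset"
begin

text \<open>
  The field of residues modulo \<open>p\<close> is \<^term>\<open>residue_ring (int p)\<close>, whose elements are the
  integers \<open>0, \<dots>, p - 1\<close>; its multiplicative group is \<^term>\<open>mult_of (residue_ring (int p))\<close>.
\<close>

definition height :: "nat \<Rightarrow> int \<Rightarrow> nat" where
  "height p x = Inf {nat \<bar>b\<bar> | b :: int. [b = x] (mod int p)}"

text \<open>
  The representative of minimal absolute value is unique if \<open>p\<close> is odd.
\<close>

definition min_rep :: "nat \<Rightarrow> int \<Rightarrow> int" where
  "min_rep p x = (THE b. [b = x] (mod int p) \<and> \<bar>b\<bar> = int (height p x))"

definition subgroup_of_order :: "nat \<Rightarrow> nat \<Rightarrow> int set" where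
  "subgroup_of_order p t =
     (THE H. subgroup H (mult_of (residue_ring (int p))) \<and> card H = t)"

lemma subgroup_of_order_ex1:
  assumes "prime p" and "t > 0" and "t dvd p - 1"
  shows "\<exists>!H. subgroup H (mult_of (residue_ring (int p))) \<and> card H = t"
proof -
  define R where "R = residue_ring (int p)"
  interpret residues_prime p R
    using assms(1) by unfold_locales (simp_all add: R_def)
  interpret M: group "mult_of R" by (rule field_mult_group)
  have fin: "finite (carrier R)" by simp
  have finM: "finite (carrier (mult_of R))" using fin by (rule finite_mult_of)
  have ordM: "order (mult_of R) = p - 1"
    using fin res_prime_units_eq[folded R_def]
    by (subst order_mult_of) (auto simp: order_def res_carrier_eq)
  have p1: "p - 1 > 0" using prime_gt_1_nat[OF assms(1)] by simp
  obtain g where g: "g \<in> carrier (mult_of R)"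
    and gen: "carrier (mult_of R) = {g [^]\<^bsub>R\<^esub> i | i :: nat. i \<in> UNIV}"
    using finite_field_mult_group_has_gen[OF fin] by blast
  have "carrier (mult_of R) = generate (mult_of R) {g}"
    using gen M.generate_pow_on_finite_carrier[OF finM g] by (simp add: nat_pow_mult_of)
  then have ordg: "M.ord g = p - 1"
    using M.generate_pow_card[OF g] ordM by (simp add: order_def)
  define h where "h = g [^]\<^bsub>mult_of R\<^esub> ((p - 1) div t)"
  have h: "h \<in> carrier (mult_of R)" unfolding h_def by (rule M.nat_pow_closed[OF g])
  obtain d where d: "p - 1 = t * d" using assms(3) by blast
  then have "d > 0" using p1 by (cases d) simp_all
  have "(p - 1) div t = d" using d assms(2) by simp
  then have "M.ord h = (p - 1) div d"
    unfolding h_def using M.ord_pow[OF g, of d] ordg d \<open>d > 0\<close> by simp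
  also have "\<dots> = t" using d \<open>d > 0\<close> by simp
  finally have "card (generate (mult_of R) {h}) = t"
    using M.generate_pow_card[OF h] by simp
  moreover have "subgroup (generate (mult_of R) {h}) (mult_of R)"
    using h by (intro M.generate_is_subgroup) simp
  moreover have "H = {x \<in> carrier R. x [^]\<^bsub>R\<^esub> t = \<one>\<^bsub>R\<^esub>}"
    if H: "subgroup H (mult_of R)" "card H = t" for H
  proof (rule card_seteq)
    show "finite {x \<in> carrier R. x [^]\<^bsub>R\<^esub> t = \<one>\<^bsub>R\<^esub>}" using fin by simp
    show "card {x \<in> carrier R. x [^]\<^bsub>R\<^esub> t = \<one>\<^bsub>R\<^esub>} \<le> card H"
      using num_roots_le_deg[OF fin, of t] assms(2) H(2) by simp
    show "H \<subseteq> {x \<in> carrier R. x [^]\<^bsub>R\<^esub> t = \<one>\<^bsub>R\<^esub>}"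
    proof
      fix x assume x: "x \<in> H"
      interpret K: group "(mult_of R)\<lparr>carrier := H\<rparr>"
        using M.subgroup_imp_group[OF H(1)] .
      have "x [^]\<^bsub>(mult_of R)\<lparr>carrier := H\<rparr>\<^esub> order ((mult_of R)\<lparr>carrier := H\<rparr>)
              = \<one>\<^bsub>(mult_of R)\<lparr>carrier := H\<rparr>\<^esub>"
        using x by (intro K.pow_order_eq_1) simp
      then have "x [^]\<^bsub>mult_of R\<^esub> t = \<one>\<^bsub>mult_of R\<^esub>"
        using H(2) by (simp add: order_def M.nat_pow_consistent[symmetric])
      moreover have "x \<in> carrier R"
        using subgroup.subset[OF H(1)] x by auto
      ultimately show "x \<in> {x \<in> carrier R. x [^]\<^bsub>R\<^esub> t = \<one>\<^bsub>R\<^esub>}"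
        by (simp add: nat_pow_mult_of)
    qed
  qed
  ultimately have "\<exists>!H. subgroup H (mult_of R) \<and> card H = t" by metis
  then show ?thesis by (simp add: R_def)
qed

definition U :: "nat \<Rightarrow> nat \<Rightarrow> nat \<Rightarrow> int \<Rightarrow> int set" where
  "U p k t a =
     {x \<in> a <#\<^bsub>mult_of (residue_ring (int p))\<^esub> subgroup_of_order p t. height p x \<le> k}"

definition Psi :: "real \<Rightarrow> real \<Rightarrow> nat" where
  "Psi x y = card {n :: nat. n > 0 \<and> real n \<le> x \<and> (\<forall>q. prime q \<longrightarrow> q dvd n \<longrightarrow> real q \<le> y)}"

text \<open>
  The value at \<open>0\<close> encodes the convention that the smooth integers of index \<open>0\<close> are those without
  prime factors.
\<close>

definition nth_prime :: "nat \<Rightarrow> nat" where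
  "nth_prime j = (if j = 0 then 1 else enumerate {q. prime q} (j - 1))"

definition r0 :: "nat \<Rightarrow> nat \<Rightarrow> nat" where
  "r0 p k = nat \<lfloor>ln (real p / 2) / ln (real k)\<rfloor>"

text \<open>
  The maximum is over a finite nonempty set whenever \<open>r0 p k \<ge> 1\<close> and \<open>t \<ge> 1\<close>, hence in
  particular for \<open>1 < k < p / 2\<close>.
\<close>

definition s0 :: "nat \<Rightarrow> nat \<Rightarrow> nat \<Rightarrow> nat" where
  "s0 p k t = Max {s'. (r0 p k + s') choose s' \<le> t}"

end

theory Submission
  imports Defs "HOL-Library.Function_Algebras"
begin

text \<open>
  Let \<open>y\<^sub>0\<close> be the representative of \<open>x\<^sub>0\<close> and \<open>y\<^sub>1, \<dots>, y\<^sub>m\<close> those of elements \<open>x\<close> with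
  \<open>(x, x\<^sub>0) = 1\<close> and distinct heights. All monomials of degree \<open>r = r0 p k\<close> in \<open>y\<^sub>0, \<dots>, y\<^sub>m\<close> lie in the
  coset \<open>a\<^sup>r G\<close>, and there are \<open>(r + m) choose m\<close> exponent vectors. For \<open>m = s + 1\<close> this exceeds \<open>t\<close>, so
  two monomials agree modulo \<open>p\<close>; having absolute value below \<open>p / 2\<close>, they agree as integers.
  By coprimality the power of \<open>y\<^sub>0\<close> can be dropped, which leaves a multiplicative relation among
  \<open>\<bar>y\<^sub>1\<bar>, \<dots>, \<bar>y\<^sub>m\<bar>\<close>. Hence the heights to be counted have multiplicative rank at most \<open>s\<close>.

  The exponent vectors of a set of integers of multiplicative rank \<open>d\<close> are determined by their
  coordinates at \<open>d\<close> suitable primes \<open>q\<^sub>1 < \<dots> < q\<^sub>d\<close>. Keeping only these primes in the factorisation and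
  replacing \<open>q\<^sub>i\<close> by the \<open>i\<close>-th prime is therefore injective, does not increase the integer, and
  yields smooth integers.
\<close>

section \<open>Linear algebra over the rationals\<close>

interpretation rat_fun: vector_space "\<lambda>(c::rat) (f::nat \<Rightarrow> rat). (\<lambda>x. c * f x)"
  by unfold_locales (auto simp: fun_eq_iff algebra_simps)

text \<open>Vectors in a space of dimension d are determined by d suitable coordinates. Induction on
  \<open>B\<close>: if \<open>Q\<close> fails for the enlarged span, the vectors there that vanish
  on \<open>Q\<close> are all multiples of a single \<open>w\<close>, and adding one coordinate at
  which \<open>w\<close> is nonzero repairs the failure.\<close>

lemma span_determined_by_coordinates:
  assumes "finite B"
  shows "\<exists>Q. finite Q \<and> card Q \<le> card B \<and>
    (\<forall>u \<in> rat_fun.span B. (\<forall>q\<in>Q. u q = 0) \<longrightarrow> u = 0)"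
  using assms
proof (induction B)
  case empty
  show ?case by (rule exI[of _ "{}"]) simp
next
  case (insert b B)
  then obtain Q where Q: "finite Q" "card Q \<le> card B"
    "\<And>u. u \<in> rat_fun.span B \<Longrightarrow> (\<forall>q\<in>Q. u q = 0) \<Longrightarrow> u = 0" by blast
  show ?case
  proof (cases "\<forall>u \<in> rat_fun.span (insert b B). (\<forall>q\<in>Q. u q = 0) \<longrightarrow> u = 0")
    case True
    moreover have "card Q \<le> card (insert b B)" using Q(2) insert.hyps by simp
    ultimately show ?thesis using Q(1) by (intro exI[of _ Q] conjI)
  next
    case False
    then obtain w where w: "w \<in> rat_fun.span (insert b B)" "\<forall>q\<in>Q. w q = 0" "w \<noteq> 0" by blast
    then obtain q where q: "w q \<noteq> 0" by (auto simp: fun_eq_iff)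
    obtain d where d: "w - (\<lambda>x. d * b x) \<in> rat_fun.span B"
      using w(1) by (auto simp: rat_fun.span_insert)
    have "d \<noteq> 0"
    proof
      assume "d = 0"
      then have "w \<in> rat_fun.span B" using d by (simp add: fun_diff_def)
      then show False using Q(3) w by blast
    qed
    have "u = 0" if u: "u \<in> rat_fun.span (insert b B)" "\<forall>i\<in>insert q Q. u i = 0" for u
    proof -
      obtain c where c: "u - (\<lambda>x. c * b x) \<in> rat_fun.span B"
        using u(1) by (auto simp: rat_fun.span_insert)
      \<comment> \<open>The factor \<open>c / d\<close> cancels the contribution of
        \<open>b\<close>, so \<open>v\<close> lies in the span of \<open>B\<close>. It vanishes on
        \<open>Q\<close>, hence is zero, and \<open>u\<close> is a multiple of
        \<open>w\<close>.\<close>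
      define v where "v = (u - (\<lambda>x. c * b x)) - (\<lambda>x. (c / d) * (w - (\<lambda>x. d * b x)) x)"
      have "v \<in> rat_fun.span B" unfolding v_def
        by (intro rat_fun.span_diff c rat_fun.span_scale[OF d])
      moreover have v: "v = (\<lambda>x. u x - (c / d) * w x)"
        using \<open>d \<noteq> 0\<close> by (auto simp: v_def fun_eq_iff field_simps)
      ultimately have "v = 0" using Q(3) u(2) w(2) by auto
      then have eq: "u x = (c / d) * w x" for x using v by (auto simp: fun_eq_iff)
      have "c / d = 0" using eq[of q] q u(2) by simp
      then show "u = 0" using eq by (auto simp: fun_eq_iff)
    qed
    moreover have "card (insert q Q) \<le> card (insert b B)"
      using Q insert.hyps by (simp add: card_insert_if)
    moreover have "finite (insert q Q)" using Q(1) by simp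
    ultimately show ?thesis by (intro exI[of _ "insert q Q"] conjI ballI impI)
  qed
qed

section \<open>Exponent vectors and smooth numbers\<close>

text \<open>The element of rank i in \<open>Q\<close> goes to the prime of rank i. This prime cannot
  exceed it, because the smaller elements of \<open>Q\<close> are themselves primes.\<close>

lemma injection_to_initial_primes:
  fixes Q :: "nat set"
  assumes "finite Q" "\<And>q. q \<in> Q \<Longrightarrow> prime q"
  obtains \<sigma> where "inj_on \<sigma> Q" "\<And>q. q \<in> Q \<Longrightarrow> prime (\<sigma> q)" "\<And>q. q \<in> Q \<Longrightarrow> \<sigma> q \<le> q"
    "\<And>q. q \<in> Q \<Longrightarrow> \<sigma> q \<le> nth_prime (card Q)"
proof -
  define P where "P = {q::nat. prime q}"
  have inf: "infinite P" unfolding P_def by (rule primes_infinite)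
  define ix where "ix q = card {q' \<in> Q. q' < q}" for q
  have ix_less: "ix q < ix q'" if "q \<in> Q" "q' \<in> Q" "q < q'" for q q'
    unfolding ix_def using that assms(1) by (intro psubset_card_mono) auto
  show thesis
  proof (rule that[of "\<lambda>q. enumerate P (ix q)"])
    show "inj_on (\<lambda>q. enumerate P (ix q)) Q"
    proof (rule inj_onI)
      fix q q' assume q: "q \<in> Q" "q' \<in> Q" "enumerate P (ix q) = enumerate P (ix q')"
      then have "ix q = ix q'"
        using inj_enumerate[OF inf] by (simp add: inj_eq)
      then show "q = q'" using ix_less[of q q'] ix_less[of q' q] q by (metis less_irrefl nat_neq_iff)
    qed
    fix q assume q: "q \<in> Q"
    show "prime (enumerate P (ix q))" using enumerate_in_set[OF inf, of "ix q"] by (simp add: P_def)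
    have "q \<in> P" using assms q by (simp add: P_def)
    then obtain j where j: "q = enumerate P j" using enumerate_Ex[OF inf] by metis
    have "{q' \<in> Q. q' < q} \<subseteq> enumerate P ` {..<j}"
    proof
      fix q' assume q': "q' \<in> {q' \<in> Q. q' < q}"
      then have "q' \<in> P" using assms by (simp add: P_def)
      then obtain i where i: "q' = enumerate P i" using enumerate_Ex[OF inf] by metis
      then have "i < j" using q' j enumerate_mono_iff[OF inf] by simp
      then show "q' \<in> enumerate P ` {..<j}" using i by simp
    qed
    then have "ix q \<le> card (enumerate P ` {..<j})" unfolding ix_def by (intro card_mono) auto
    also have "\<dots> \<le> j" using card_image_le[of "{..<j}" "enumerate P"] by simp
    finally show "enumerate P (ix q) \<le> q" unfolding j using enumerate_mono_le_iff[OF inf] by simp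
    have "ix q < card Q" unfolding ix_def using q assms(1) by (intro psubset_card_mono) auto
    \<comment> \<open>\<open>nth_prime\<close> counts from 1 and \<open>enumerate\<close> from 0, so
      the index to compare with is \<open>card Q - 1\<close>; since \<open>Q\<close> is nonempty,
      the exceptional value of \<open>nth_prime\<close> at 0 does not arise.\<close>
    then have "ix q \<le> card Q - 1" "card Q \<noteq> 0" by auto
    then show "enumerate P (ix q) \<le> nth_prime (card Q)"
      using enumerate_mono_le_iff[OF inf] by (simp add: nth_prime_def P_def[symmetric])
  qed
qed

lemma nth_prime_mono:
  assumes "i \<le> j"
  shows "nth_prime i \<le> nth_prime j"
proof (cases "i = 0")
  case True
  have "prime (enumerate {q::nat. prime q} (j - 1))"
    using enumerate_in_set[OF primes_infinite, of "j - 1"] by simp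
  then show ?thesis using True prime_ge_1_nat by (simp add: nth_prime_def)
next
  case False
  then show ?thesis
    using assms enumerate_mono_le_iff[OF primes_infinite] by (simp add: nth_prime_def diff_le_mono)
qed

text \<open>Since \<open>\<sigma>\<close> is injective, the exponents of \<open>n\<close> at
  \<open>Q\<close> can be read off from \<open>F n\<close>, so \<open>F\<close> is injective on
  \<open>A\<close>. Since \<open>\<sigma>\<close> does not increase primes, \<open>F n\<close> is at
  most the part of \<open>n\<close> supported on \<open>Q\<close>, which divides
  \<open>n\<close>.\<close>

lemma card_determined_by_primes_le_Psi:
  fixes A :: "nat set"
  assumes Q: "finite Q" "\<And>q. q \<in> Q \<Longrightarrow> prime q" "card Q \<le> s"
    and A: "A \<subseteq> {1..k}"
    and det: "\<And>m n. m \<in> A \<Longrightarrow> n \<in> A \<Longrightarrow> (\<forall>q\<in>Q. multiplicity q m = multiplicity q n) \<Longrightarrow> m = n"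
  shows "card A \<le> Psi (real k) (real (nth_prime s))"
proof -
  obtain \<sigma> where \<sigma>: "inj_on \<sigma> Q" "\<And>q. q \<in> Q \<Longrightarrow> prime (\<sigma> q)" "\<And>q. q \<in> Q \<Longrightarrow> \<sigma> q \<le> q"
    "\<And>q. q \<in> Q \<Longrightarrow> \<sigma> q \<le> nth_prime (card Q)"
    using injection_to_initial_primes[OF Q(1,2)] by metis
  define F where "F n = (\<Prod>q\<in>Q. \<sigma> q ^ multiplicity q n)" for n
  define S where "S = {n :: nat. n > 0 \<and> real n \<le> real k \<and>
    (\<forall>q. prime q \<longrightarrow> q dvd n \<longrightarrow> real q \<le> real (nth_prime s))}"
  have mult: "multiplicity (\<sigma> q) (F n) = multiplicity q n" if "q \<in> Q" for q n
  proof -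
    \<comment> \<open>Reindexing over the image of \<open>\<sigma>\<close> makes the primes
      themselves the indices, the form in which multiplicities can be read off.\<close>
    have "F n = (\<Prod>r\<in>\<sigma> ` Q. r ^ multiplicity (the_inv_into Q \<sigma> r) n)"
      unfolding F_def using \<sigma>(1) by (simp add: prod.reindex the_inv_into_f_f)
    also have "multiplicity (\<sigma> q) \<dots> = (if \<sigma> q \<in> \<sigma> ` Q then multiplicity (the_inv_into Q \<sigma> (\<sigma> q)) n else 0)"
      using that \<sigma> Q(1) by (intro multiplicity_prod_prime_powers) auto
    finally show ?thesis using that \<sigma>(1) by (simp add: the_inv_into_f_f)
  qed
  have "inj_on F A" by (rule inj_onI, rule det) (auto simp: mult[symmetric])
  moreover have "F ` A \<subseteq> S"
  proof
    fix y assume "y \<in> F ` A"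
    then obtain n where n: "n \<in> A" "y = F n" by blast
    then have n0: "n > 0" "n \<le> k" using A by auto
    have "F n \<le> (\<Prod>q\<in>Q. q ^ multiplicity q n)"
      unfolding F_def using \<sigma>(3) by (intro prod_mono) (auto intro: power_mono)
    also have "\<dots> \<le> n"
    proof (rule dvd_imp_le[OF multiplicity_le_imp_dvd n0(1)])
      show "(\<Prod>q\<in>Q. q ^ multiplicity q n) \<noteq> 0" using Q by (auto dest: prime_gt_0_nat)
      show "multiplicity r (\<Prod>q\<in>Q. q ^ multiplicity q n) \<le> multiplicity r n" if "prime r" for r
        using Q that by (simp add: multiplicity_prod_prime_powers)
    qed
    finally have "F n \<le> k" using n0 by linarith
    moreover have "F n > 0" unfolding F_def using \<sigma>(2) by (simp add: prod_pos prime_gt_0_nat)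
    moreover have "real r \<le> real (nth_prime s)" if r: "prime r" "r dvd F n" for r
    proof -
      obtain q where q: "q \<in> Q" "r dvd \<sigma> q ^ multiplicity q n"
        using r Q(1) by (auto simp: F_def prime_dvd_prod_iff)
      then have "r = \<sigma> q" using r \<sigma>(2) by (meson prime_dvd_power primes_dvd_imp_eq)
      then show ?thesis using \<sigma>(4)[OF q(1)] nth_prime_mono[OF Q(3)] by simp
    qed
    ultimately show "y \<in> S" using n by (auto simp: S_def)
  qed
  moreover have "finite S" by (rule finite_subset[of _ "{..k}"]) (auto simp: S_def)
  ultimately have "card A \<le> card S" using card_inj_on_le by blast
  then show ?thesis by (simp add: Psi_def S_def)
qed

text \<open>A coincidence of two products over \<open>C\<close> is a linear relation between
  exponent vectors with coefficients \<open>e c - f c\<close>. Hence the exponent vectors of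
  \<open>A\<close> span a space of dimension at most \<open>s\<close>, and at most \<open>s\<close>
  primes tell the members of \<open>A\<close> apart.\<close>

lemma card_le_Psi_of_multiplicative_rank:
  fixes A :: "nat set"
  assumes A: "A \<subseteq> {1..k}"
    and dep: "\<And>C. C \<subseteq> A \<Longrightarrow> card C = Suc s \<Longrightarrow>
      \<exists>e f :: nat \<Rightarrow> nat. (\<exists>c\<in>C. e c \<noteq> f c) \<and> (\<Prod>c\<in>C. c ^ e c) = (\<Prod>c\<in>C. c ^ f c)"
  shows "card A \<le> Psi (real k) (real (nth_prime s))"
proof -
  \<comment> \<open>Coordinates at non-primes are set to zero because multiplicity at a composite
    number is not additive on products.\<close>
  define v :: "nat \<Rightarrow> nat \<Rightarrow> rat"
    where "v n = (\<lambda>q. if prime q then of_nat (multiplicity q n) else 0)" for n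
  have finA: "finite A" using A by (rule finite_subset) simp
  have inj: "inj_on v A"
  proof (rule inj_onI)
    fix m n assume mn: "m \<in> A" "n \<in> A" "v m = v n"
    show "m = n"
    proof (rule multiplicity_eq_nat)
      show "m > 0" "n > 0" using mn A by auto
      show "multiplicity q m = multiplicity q n" if "prime q" for q
        using fun_cong[OF mn(3), of q] that by (simp add: v_def)
    qed
  qed
  \<comment> \<open>The basis is taken among the vectors \<open>v n\<close> themselves, so that
    \<open>Suc s\<close> of its members would come from a set \<open>C\<close> to which
    \<open>dep\<close> applies.\<close>
  obtain B where B: "B \<subseteq> v ` A" "rat_fun.independent B" "v ` A \<subseteq> rat_fun.span B"
    using rat_fun.maximal_independent_subset[of "v ` A"] by metis
  have finB: "finite B" using B(1) finA by (meson finite_surj)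
  have "card B \<le> s"
  proof (rule ccontr)
    assume "\<not> card B \<le> s"
    then obtain D where D: "D \<subseteq> B" "card D = Suc s" 
      by (meson not_less_eq_eq obtain_subset_with_card_n)
    obtain C where C: "C \<subseteq> A" "D = v ` C" using D(1) B(1) by (meson subset_imageE subset_trans)
    have injC: "inj_on v C" using inj C(1) inj_on_subset by blast
    have finC: "finite C" using C(1) finA finite_subset by blast
    have "card C = Suc s" using D(2) C(2) injC card_image by metis
    then obtain e f :: "nat \<Rightarrow> nat" where ef: "\<exists>c\<in>C. e c \<noteq> f c"
      "(\<Prod>c\<in>C. c ^ e c) = (\<Prod>c\<in>C. c ^ f c)"
      using dep[OF C(1)] by blast
    have pos: "c \<noteq> 0" if "c \<in> C" for c using that C(1) A by auto
    have mult: "multiplicity q (\<Prod>c\<in>C. c ^ g c) = (\<Sum>c\<in>C. g c * multiplicity q c)"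
      if "prime q" for q and g :: "nat \<Rightarrow> nat"
    proof -
      have "0 \<notin> (\<lambda>c. c ^ g c) ` C" using pos[of 0] by auto
      then show ?thesis
        using that pos finC
        by (simp add: prime_elem_multiplicity_prod_distrib prime_elem_multiplicity_power_distrib)
    qed
    define u :: "(nat \<Rightarrow> rat) \<Rightarrow> rat"
      where "u w = of_nat (e (the_inv_into C v w)) - of_nat (f (the_inv_into C v w))" for w
    have "(\<Sum>w\<in>D. (\<lambda>x. u w * w x)) x = 0" for x
    proof -
      have "(\<Sum>w\<in>D. (\<lambda>x. u w * w x)) x = (\<Sum>w\<in>D. u w * w x)"
        by (induction D rule: infinite_finite_induct) auto
      also have "\<dots> = (\<Sum>c\<in>C. (of_nat (e c) - of_nat (f c)) * v c x)"
        unfolding C(2) using injC by (simp add: sum.reindex u_def the_inv_into_f_f)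
      also have "\<dots> = 0"
      proof (cases "prime x")
        case True
        then have "(\<Sum>c\<in>C. e c * multiplicity x c) = (\<Sum>c\<in>C. f c * multiplicity x c)"
          using ef(2) mult[of x e] mult[of x f] by simp
        then have "(of_nat (\<Sum>c\<in>C. e c * multiplicity x c) :: rat)
            = of_nat (\<Sum>c\<in>C. f c * multiplicity x c)" by simp
        then show ?thesis using True by (simp add: v_def left_diff_distrib sum_subtractf)
      qed (simp add: v_def)
      finally show ?thesis .
    qed
    then have "(\<Sum>w\<in>D. (\<lambda>x. u w * w x)) = 0" by (simp add: fun_eq_iff)
    then have "u w = 0" if "w \<in> D" for w
      using rat_fun.independentD[OF B(2) _ D(1)] that finC C(2) by blast
    then have "e c = f c" if "c \<in> C" for c
      using that C(2) injC by (force simp: u_def the_inv_into_f_f)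
    then show False using ef(1) by blast
  qed
  obtain Q where Q: "finite Q" "card Q \<le> card B"
    "\<And>u. u \<in> rat_fun.span B \<Longrightarrow> (\<forall>q\<in>Q. u q = 0) \<Longrightarrow> u = 0"
    using span_determined_by_coordinates[OF finB] by blast
  show ?thesis
  \<comment> \<open>All vectors \<open>v n\<close> vanish at non-primes, so these coordinates can be
    discarded from \<open>Q\<close>.\<close>
  proof (rule card_determined_by_primes_le_Psi[where Q = "{q\<in>Q. prime q}"])
    have "card {q\<in>Q. prime q} \<le> card Q" using Q(1) by (intro card_mono) auto
    then show "card {q\<in>Q. prime q} \<le> s" using Q(2) \<open>card B \<le> s\<close> by simp
    fix m n assume mn: "m \<in> A" "n \<in> A" "\<forall>q\<in>{q\<in>Q. prime q}. multiplicity q m = multiplicity q n"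
    have "v m - v n \<in> rat_fun.span B" using B(3) mn by (intro rat_fun.span_diff) auto
    moreover have "\<forall>q\<in>Q. (v m - v n) q = 0" using mn(3) by (auto simp: v_def)
    ultimately have "v m - v n = 0" using Q(3) by blast
    then show "m = n" using inj mn by (auto simp: inj_on_def)
  qed (use Q A in auto)
qed

section \<open>Monomials in a coset modulo \<open>p\<close>\<close>

text \<open>The factors \<open>a\<close> add up to the degree, and the remaining factors stay in
  \<open>G\<close>. Working with congruences lets the \<open>y i\<close> be signed integers instead
  of elements of the residue ring.\<close>

lemma monomial_cong_coset:
  fixes p m :: nat and y :: "nat \<Rightarrow> int" and a :: int
  assumes one: "1 \<in> G" and mult: "\<And>g h. g \<in> G \<Longrightarrow> h \<in> G \<Longrightarrow> (g * h) mod int p \<in> G"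
    and y: "\<And>i. i < m \<Longrightarrow> \<exists>g\<in>G. [y i = a * g] (mod int p)"
  shows "\<exists>g\<in>G. [(\<Prod>i<m. y i ^ e i) = a ^ (\<Sum>i<m. e i) * g] (mod int p)"
proof -
  have step: "\<exists>g\<in>G. [b * c = a ^ (i + j) * g] (mod int p)"
    if "\<exists>g\<in>G. [b = a ^ i * g] (mod int p)" "\<exists>g\<in>G. [c = a ^ j * g] (mod int p)" for b c i j
  proof -
    from that obtain g h
      where gh: "g \<in> G" "h \<in> G" "[b = a ^ i * g] (mod int p)" "[c = a ^ j * h] (mod int p)"
      by blast
    have "[b * c = (a ^ i * g) * (a ^ j * h)] (mod int p)" using gh by (intro cong_mult)
    also have "(a ^ i * g) * (a ^ j * h) = a ^ (i + j) * (g * h)" by (simp add: power_add)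
    also have "[\<dots> = a ^ (i + j) * ((g * h) mod int p)] (mod int p)"
      by (intro cong_mult) (simp_all add: cong_def)
    finally show ?thesis using mult gh by blast
  qed
  have pow: "\<exists>g\<in>G. [y i ^ n = a ^ n * g] (mod int p)" if "i < m" for i n
  proof (induction n)
    case 0
    show ?case using one by (intro bexI[of _ 1]) simp_all
  next
    case (Suc n)
    then show ?case using step[of "y i" 1 "y i ^ n" n] y[OF that] by simp
  qed
  have "\<exists>g\<in>G. [(\<Prod>i<n. y i ^ e i) = a ^ (\<Sum>i<n. e i) * g] (mod int p)" if "n \<le> m" for n
    using that
  proof (induction n)
    case 0
    show ?case using one by (intro bexI[of _ 1]) simp_all
  next
    case (Suc n)
    then show ?case
      using step[of "\<Prod>i<n. y i ^ e i" "\<Sum>i<n. e i" "y n ^ e n" "e n"] pow[of n] by simp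
  qed
  then show ?thesis by simp
qed

text \<open>Pigeonhole: stars and bars counts the exponent vectors of degree \<open>r\<close>, while
  the monomials take at most \<open>card G\<close> residues. Two congruent monomials differ by at
  most \<open>2 * k ^ r < p\<close> in absolute value, so they are equal.\<close>

lemma equal_monomials_of_few_residues:
  fixes p m k r :: nat and y :: "nat \<Rightarrow> int" and a :: int
  assumes one: "1 \<in> G" and mult: "\<And>g h. g \<in> G \<Longrightarrow> h \<in> G \<Longrightarrow> (g * h) mod int p \<in> G"
    and y: "\<And>i. i < m \<Longrightarrow> \<exists>g\<in>G. [y i = a * g] (mod int p)"
    and bound: "\<And>i. i < m \<Longrightarrow> \<bar>y i\<bar> \<le> int k"
    and small: "2 * k ^ r < p"
    and fin: "finite G" and few: "card G < (r + m - 1) choose r"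
  obtains e f where "length e = m" "length f = m" "sum_list e = r" "sum_list f = r" "e \<noteq> f"
    "(\<Prod>i<m. y i ^ (e ! i)) = (\<Prod>i<m. y i ^ (f ! i))"
proof -
  define L where "L = {l :: nat list. length l = m \<and> sum_list l = r}"
  define M where "M l = (\<Prod>i<m. y i ^ (l ! i))" for l
  have sum: "(\<Sum>i<m. l ! i) = r" if "l \<in> L" for l
    using that sum_list_sum_nth[of l] by (auto simp: L_def atLeast0LessThan)
  have "(\<lambda>l. M l mod int p) ` L \<subseteq> (\<lambda>g. (a ^ r * g) mod int p) ` G"
  proof
    fix x assume "x \<in> (\<lambda>l. M l mod int p) ` L"
    then obtain l where l: "l \<in> L" "x = M l mod int p" by blast
    obtain g where "g \<in> G" "[M l = a ^ r * g] (mod int p)"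
      using monomial_cong_coset[of G p m y a "\<lambda>i. l ! i"] one mult y sum[OF l(1)]
      unfolding M_def by auto
    then show "x \<in> (\<lambda>g. (a ^ r * g) mod int p) ` G" using l by (auto simp: cong_def)
  qed
  then have "card ((\<lambda>l. M l mod int p) ` L) \<le> card ((\<lambda>g. (a ^ r * g) mod int p) ` G)"
    using fin by (intro card_mono) auto
  also have "\<dots> \<le> card G" using fin by (rule card_image_le)
  also have "\<dots> < card L" using few by (simp add: L_def card_length_sum_list)
  finally have "\<not> inj_on (\<lambda>l. M l mod int p) L" by (rule pigeonhole)
  then obtain e f where ef: "e \<in> L" "f \<in> L" "e \<noteq> f" "M e mod int p = M f mod int p"
    by (auto simp: inj_on_def)
  have M_le: "\<bar>M l\<bar> \<le> int k ^ r" if "l \<in> L" for l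
  proof -
    have "\<bar>M l\<bar> = (\<Prod>i<m. \<bar>y i\<bar> ^ (l ! i))" by (simp add: M_def abs_prod power_abs)
    also have "\<dots> \<le> (\<Prod>i<m. int k ^ (l ! i))" using bound by (intro prod_mono) (auto intro: power_mono)
    also have "\<dots> = int k ^ r" using sum[OF that] by (simp add: power_sum[symmetric])
    finally show ?thesis .
  qed
  have "int p dvd M e - M f" using ef(4) by (simp add: mod_eq_dvd_iff)
  moreover have "\<bar>M e - M f\<bar> < int p"
  proof -
    have "2 * int k ^ r < int p" using small by (metis of_nat_less_iff of_nat_mult of_nat_numeral of_nat_power)
    then show ?thesis using M_le[OF ef(1)] M_le[OF ef(2)] by linarith
  qed
  ultimately have "M e = M f" using dvd_imp_le_int[of "M e - M f" "int p"] by force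
  then show thesis using that[of e f] ef unfolding L_def M_def by blast
qed

section \<open>Minimal representatives, coprimality, and the sizes of \<open>r0\<close> and
  \<open>s0\<close>\<close>

text \<open>A second candidate for the definite description could only be \<open>- b\<close>. Then
  \<open>p\<close> divides \<open>2 * b\<close>, hence \<open>b\<close> as \<open>p\<close> is an
  odd prime; so the height is 0 and the candidates coincide.\<close>

lemma min_rep_cong_abs:
  assumes "prime p" "p > 2"
  shows "[min_rep p x = x] (mod int p)" "\<bar>min_rep p x\<bar> = int (height p x)"
proof -
  let ?S = "{nat \<bar>b\<bar> | b :: int. [b = x] (mod int p)}"
  have "?S \<noteq> {}" by (auto intro: exI[of _ x])
  then have "height p x \<in> ?S" unfolding height_def by (rule Inf_nat_def1)
  then obtain b where b: "[b = x] (mod int p)" "\<bar>b\<bar> = int (height p x)" by auto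
  have "\<exists>!b. [b = x] (mod int p) \<and> \<bar>b\<bar> = int (height p x)"
  proof (rule ex1I[of _ b], use b in blast)
    fix c assume c: "[c = x] (mod int p) \<and> \<bar>c\<bar> = int (height p x)"
    show "c = b"
    proof (rule ccontr)
      assume "c \<noteq> b"
      then have "c = - b" using c b by linarith
      then have "[- b = b] (mod int p)" using b c cong_sym cong_trans by blast
      then have "int p dvd 2 * b" by (simp add: cong_iff_dvd_diff)
      moreover have "\<not> int p dvd 2" using assms(2) zdvd_imp_le[of "int p" 2] by auto
      ultimately have "int p dvd b" using assms(1) by (simp add: prime_dvd_mult_iff)
      then have "[0 = x] (mod int p)" using b(1) by (metis cong_0_iff cong_sym cong_trans)
      then have "0 \<in> ?S" by force
      then have "height p x \<le> 0" unfolding height_def by (rule cInf_lower) simp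
      then show False using b c \<open>c \<noteq> b\<close> by simp
    qed
  qed
  from theI'[OF this] show "[min_rep p x = x] (mod int p)" "\<bar>min_rep p x\<bar> = int (height p x)"
    unfolding min_rep_def by auto
qed

text \<open>Serves to strip the powers of the height of \<open>x\<^sub>0\<close> from a relation:
  each of \<open>X\<close> and \<open>Y\<close> divides the opposite side and is coprime to
  \<open>c\<close>, so they divide each other.\<close>

lemma eq_of_coprime_power_mult_eq:
  fixes c X Y :: nat
  assumes "c ^ i * X = c ^ j * Y" "coprime X c" "coprime Y c"
  shows "X = Y"
proof (rule dvd_antisym)
  have "X dvd c ^ j * Y" "Y dvd c ^ i * X" using assms(1) by (metis dvd_triv_right)+
  then show "X dvd Y" "Y dvd X"
    using assms(2,3) by (simp_all add: coprime_dvd_mult_right_iff)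
qed

text \<open>The floor in \<open>r0\<close> gives only the weak inequality; it is strict because the
  left side is even and \<open>p\<close> is odd.\<close>

lemma two_power_r0_less:
  assumes "odd p" "1 < k" "real k < real p / 2"
  shows "2 * k ^ r0 p k < p"
proof -
  have ln: "ln (real k) > 0" "ln (real p / 2) > 0" using assms by auto
  have "real (r0 p k) = of_int \<lfloor>ln (real p / 2) / ln (real k)\<rfloor>"
    using ln by (simp add: r0_def)
  also have "\<dots> \<le> ln (real p / 2) / ln (real k)" by (rule of_int_floor_le)
  finally have "ln (real k ^ r0 p k) \<le> ln (real p / 2)"
    using ln assms by (simp add: ln_realpow pos_le_divide_eq)
  then have "real k ^ r0 p k \<le> real p / 2" using assms by simp
  then have "real (2 * k ^ r0 p k) \<le> real p" by simp
  then have "2 * k ^ r0 p k \<le> p" by (simp only: of_nat_le_iff)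
  moreover have "2 * k ^ r0 p k \<noteq> p" using assms(1) by (rule contrapos_nn) (metis dvd_triv_left)
  ultimately show ?thesis by simp
qed

lemma r0_ge_1:
  assumes "1 < k" "real k < real p / 2"
  shows "r0 p k \<ge> 1"
proof -
  have "ln (real k) \<le> ln (real p / 2)" using assms by simp
  then have "1 \<le> ln (real p / 2) / ln (real k)" using assms by (simp add: pos_le_divide_eq)
  then show ?thesis by (simp add: r0_def le_nat_iff)
qed

text \<open>Maximality of \<open>s0\<close>, once the set under \<open>Max\<close> is known to be
  finite: for \<open>r0 p k \<ge> 1\<close> the binomial coefficient is at least
  \<open>s' + 1\<close>, which bounds \<open>s'\<close> by \<open>t\<close>.\<close>

lemma less_choose_Suc_s0:
  assumes "r0 p k \<ge> 1" "t > 0"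
  shows "t < (r0 p k + Suc (s0 p k t)) choose Suc (s0 p k t)"
proof (rule ccontr)
  let ?S = "{s'. (r0 p k + s') choose s' \<le> t}"
  have "?S \<subseteq> {..t}"
  proof
    fix s' assume "s' \<in> ?S"
    then have "(r0 p k + s') choose s' \<le> t" by simp
    moreover have "(1 + s') choose s' \<le> (r0 p k + s') choose s'"
      using assms(1) by (intro binomial_right_mono) simp
    ultimately show "s' \<in> {..t}" by simp
  qed
  then have "finite ?S" by (rule finite_subset) simp
  moreover assume "\<not> ?thesis"
  ultimately have "Suc (s0 p k t) \<le> Max ?S" by (intro Max_ge) auto
  then show False by (simp add: s0_def)
qed

section \<open>From the coset to a multiplicative relation among heights\<close>

theorem theorem1p2:
  fixes p t k :: nat and a x\<^sub>0 :: int
  assumes "prime p" and "p > 2"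
    and "t > 0" and "t dvd p - 1"
    and "1 < k" and "real k < real p / 2"
    and "a \<in> carrier (mult_of (residue_ring (int p)))"
    and "x\<^sub>0 \<in> U p k t a"
  shows "card {height p x | x. x \<in> U p k t a \<and> gcd (min_rep p x) (min_rep p x\<^sub>0) = 1}
           \<le> Psi (real k) (real (nth_prime (s0 p k t)))"
proof -
  define R where "R = residue_ring (int p)"
  interpret residues_prime p R
    using assms(1) by unfold_locales (simp_all add: R_def)
  interpret M: group "mult_of R" by (rule field_mult_group)
  define G where "G = subgroup_of_order p t"
  define s where "s = s0 p k t"
  define r where "r = r0 p k"
  have G: "subgroup G (mult_of R)" "card G = t"
    using theI'[OF subgroup_of_order_ex1[OF assms(1,3,4)]]
    by (simp_all add: G_def subgroup_of_order_def R_def)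
  have fin: "finite G" using G(2) assms(3) by (simp add: card_ge_0_finite)
  have one: "1 \<in> G" using subgroup.one_closed[OF G(1)] by (simp add: res_one_eq)
  have mult: "(g * h) mod int p \<in> G" if "g \<in> G" "h \<in> G" for g h
    using subgroup.m_closed[OF G(1) that] by (simp add: res_mult_eq)
  have U: "\<exists>g\<in>G. x = (a * g) mod int p" "x \<in> carrier (mult_of R)" "height p x \<le> k"
    if x: "x \<in> U p k t a" for x
  proof -
    obtain g where g: "g \<in> G" "x = a \<otimes>\<^bsub>mult_of R\<^esub> g"
      using x by (auto simp: U_def l_coset_def G_def R_def)
    show "x \<in> carrier (mult_of R)"
      unfolding g(2) using subgroup.mem_carrier[OF G(1) g(1)] assms(7)
      by (intro M.m_closed) (simp_all add: R_def)
    show "\<exists>g\<in>G. x = (a * g) mod int p" using g by (auto simp: res_mult_eq)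
    show "height p x \<le> k" using x by (simp add: U_def)
  qed
  have mr: "[min_rep p x = x] (mod int p)" "\<bar>min_rep p x\<bar> = int (height p x)" for x
    using min_rep_cong_abs[OF assms(1,2)] by auto
  \<comment> \<open>Height 0 would make \<open>x\<close> divisible by \<open>p\<close>, but elements
    of the multiplicative group are integers from 1 to \<open>p - 1\<close>.\<close>
  have pos: "height p x > 0" if "x \<in> U p k t a" for x
  proof (rule ccontr)
    assume "\<not> ?thesis"
    then have "[0 = x] (mod int p)" using mr[of x] by simp
    moreover have "x \<noteq> 0" "x \<ge> 0" "x < int p"
      using U(2)[OF that] by (auto simp: res_carrier_eq res_zero_eq)
    ultimately show False by (simp add: cong_def)
  qed
  have coset: "\<exists>g\<in>G. [min_rep p x = a * g] (mod int p)" if "x \<in> U p k t a" for x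
    using U(1)[OF that] mr(1)[of x] by (auto simp: cong_def)
  have "r \<ge> 1" using r0_ge_1 assms(5,6) by (simp add: r_def)
  have small: "2 * k ^ r < p"
    using two_power_r0_less[of p k] assms prime_odd_nat by (auto simp: r_def)
  have few: "t < (r + Suc s) choose Suc s"
    using less_choose_Suc_s0[of p k t] \<open>r \<ge> 1\<close> assms(3) by (simp add: r_def s_def)
  define A where "A = {height p x | x. x \<in> U p k t a \<and> gcd (min_rep p x) (min_rep p x\<^sub>0) = 1}"
  have "card A \<le> Psi (real k) (real (nth_prime s))"
  proof (rule card_le_Psi_of_multiplicative_rank)
    show "A \<subseteq> {1..k}" using pos U(3) by (fastforce simp: A_def)
    fix C assume C: "C \<subseteq> A" "card C = Suc s"
    then have "finite C" by (simp add: card_ge_0_finite)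
    then obtain \<phi> where \<phi>: "bij_betw \<phi> {..<Suc s} C"
      using ex_bij_betw_nat_finite[of C] C(2) by (auto simp: atLeast0LessThan)
    have "\<forall>c\<in>A. \<exists>x. c = height p x \<and> x \<in> U p k t a \<and> gcd (min_rep p x) (min_rep p x\<^sub>0) = 1"
      by (auto simp: A_def)
    then obtain X where X: "\<And>c. c \<in> A \<Longrightarrow> c = height p (X c)" "\<And>c. c \<in> A \<Longrightarrow> X c \<in> U p k t a"
        "\<And>c. c \<in> A \<Longrightarrow> gcd (min_rep p (X c)) (min_rep p x\<^sub>0) = 1"
      by metis
    have \<phi>A: "\<phi> i \<in> A" if "i < Suc s" for i using \<phi> C(1) that by (auto dest: bij_betwE)
    \<comment> \<open>Index \<open>0\<close> is reserved for \<open>x\<^sub>0\<close>, whose exponent makes all monomials homogeneous of degree \<open>r\<close>.\<close>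
    define z where "z i = (case i of 0 \<Rightarrow> x\<^sub>0 | Suc j \<Rightarrow> X (\<phi> j))" for i
    have z: "z i \<in> U p k t a" if "i < Suc (Suc s)" for i
      using that assms(8) X(2) \<phi>A by (auto simp: z_def split: nat.split)
    \<comment> \<open>There are \<open>Suc (Suc s)\<close> variables: the \<open>Suc s\<close>
      heights in \<open>C\<close>, and \<open>x\<^sub>0\<close>. Symmetry turns the stars-and-bars
      coefficient into the one occurring in \<open>s0\<close>.\<close>
    have choose: "(r + Suc (Suc s) - 1) choose r = (r + Suc s) choose Suc s"
      using binomial_symmetric[of r "r + Suc s"] by simp
    obtain e f where ef: "length e = Suc (Suc s)" "length f = Suc (Suc s)" "sum_list e = r"
      "sum_list f = r" "e \<noteq> f"
      "(\<Prod>i<Suc (Suc s). min_rep p (z i) ^ (e ! i)) = (\<Prod>i<Suc (Suc s). min_rep p (z i) ^ (f ! i))"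
    proof (rule equal_monomials_of_few_residues
        [of G p "Suc (Suc s)" "\<lambda>i. min_rep p (z i)" a k r, OF one mult])
      show "card G < (r + Suc (Suc s) - 1) choose r" unfolding choose using few G(2) by simp
    qed (use z coset mr(2) U(3) small fin in auto)
    obtain e0 e' where e': "e = e0 # e'" using ef(1) by (cases e) auto
    obtain f0 f' where f': "f = f0 # f'" using ef(2) by (cases f) auto
    \<comment> \<open>Absolute values turn signed monomials into products of heights, with the power
      belonging to \<open>x\<^sub>0\<close> split off.\<close>
    have nat_abs: "nat \<bar>\<Prod>i<Suc (Suc s). min_rep p (z i) ^ (l ! i)\<bar>
        = height p x\<^sub>0 ^ l0 * (\<Prod>i<Suc s. \<phi> i ^ (l' ! i))" if "l = l0 # l'" for l l0 l'
    proof -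
      have "\<bar>\<Prod>i<Suc (Suc s). min_rep p (z i) ^ (l ! i)\<bar>
          = (\<Prod>i<Suc (Suc s). int (height p (z i)) ^ (l ! i))"
        by (simp only: abs_prod power_abs mr(2))
      also have "\<dots> = int (\<Prod>i<Suc (Suc s). height p (z i) ^ (l ! i))" by simp
      also have "(\<Prod>i<Suc (Suc s). height p (z i) ^ (l ! i))
          = height p x\<^sub>0 ^ l0 * (\<Prod>i<Suc s. height p (X (\<phi> i)) ^ (l' ! i))"
        by (subst prod.lessThan_Suc_shift) (simp add: z_def that)
      also have "(\<Prod>i<Suc s. height p (X (\<phi> i)) ^ (l' ! i)) = (\<Prod>i<Suc s. \<phi> i ^ (l' ! i))"
        using X(1)[OF \<phi>A, symmetric] by (intro prod.cong) auto
      finally show ?thesis by (simp only: nat_int)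
    qed
    have "coprime (\<phi> i) (height p x\<^sub>0)" if "i < Suc s" for i
    proof -
      have "gcd \<bar>min_rep p (X (\<phi> i))\<bar> \<bar>min_rep p x\<^sub>0\<bar> = 1" using X(3)[OF \<phi>A[OF that]] by simp
      then have "gcd (height p (X (\<phi> i))) (height p x\<^sub>0) = 1" unfolding mr(2) by simp
      then show ?thesis unfolding X(1)[OF \<phi>A[OF that], symmetric] by (rule gcd_eq_1_imp_coprime)
    qed
    then have cop: "coprime (\<Prod>i<Suc s. \<phi> i ^ g i) (height p x\<^sub>0)" for g :: "nat \<Rightarrow> nat"
      by (intro prod_coprime_left) auto
    have eq: "(\<Prod>i<Suc s. \<phi> i ^ (e' ! i)) = (\<Prod>i<Suc s. \<phi> i ^ (f' ! i))"
    proof (rule eq_of_coprime_power_mult_eq[OF _ cop cop])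
      show "height p x\<^sub>0 ^ e0 * (\<Prod>i<Suc s. \<phi> i ^ (e' ! i)) = height p x\<^sub>0 ^ f0 * (\<Prod>i<Suc s. \<phi> i ^ (f' ! i))"
        unfolding nat_abs[OF e', symmetric] nat_abs[OF f', symmetric] ef(6) ..
    qed
    \<comment> \<open>Homogeneity keeps the relation nontrivial: if the tails agreed, the common
      degree \<open>r\<close> would force \<open>e0 = f0\<close> and thus
      \<open>e = f\<close>.\<close>
    have "e' \<noteq> f'"
    proof
      assume "e' = f'"
      moreover from this have "e0 = f0" using ef(3,4) unfolding e' f' by simp
      ultimately show False using ef(5) unfolding e' f' by simp
    qed
    then obtain i where i: "i < Suc s" "e' ! i \<noteq> f' ! i"
      using ef(1,2) e' f' by (auto simp: list_eq_iff_nth_eq)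
    \<comment> \<open>The relation is now transported from list positions to exponents indexed by
      the elements of \<open>C\<close>, as the rank lemma expects.\<close>
    define \<psi> where "\<psi> = the_inv_into {..<Suc s} \<phi>"
    have \<psi>: "\<psi> (\<phi> i) = i" if "i < Suc s" for i
      using \<phi> that by (simp add: \<psi>_def bij_betw_def the_inv_into_f_f)
    have reindex: "(\<Prod>c\<in>C. c ^ (l ! \<psi> c)) = (\<Prod>i<Suc s. \<phi> i ^ (l ! i))" for l :: "nat list"
      using prod.reindex_bij_betw[OF \<phi>, of "\<lambda>c. c ^ (l ! \<psi> c)"] \<psi> by simp
    have "\<exists>c\<in>C. e' ! \<psi> c \<noteq> f' ! \<psi> c"
    proof
      show "\<phi> i \<in> C" using \<phi> i(1) by (auto dest: bij_betwE)
      show "e' ! \<psi> (\<phi> i) \<noteq> f' ! \<psi> (\<phi> i)" using i \<psi> by simp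
    qed
    moreover have "(\<Prod>c\<in>C. c ^ (e' ! \<psi> c)) = (\<Prod>c\<in>C. c ^ (f' ! \<psi> c))"
      unfolding reindex by (rule eq)
    ultimately show "\<exists>e f :: nat \<Rightarrow> nat. (\<exists>c\<in>C. e c \<noteq> f c) \<and> (\<Prod>c\<in>C. c ^ e c) = (\<Prod>c\<in>C. c ^ f c)"
      by (intro exI[of _ "\<lambda>c. e' ! \<psi> c"] exI[of _ "\<lambda>c. f' ! \<psi> c"] conjI)
  qed
  then show ?thesis by (simp add: A_def s_def)
qed

end
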